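(* Let $w\in R_n(1/24/3)$ have largest letter $m$, and let $l$ be the number of $1$s in $w$. Then $w$ has one of the following forms: (A) $m\le2$; (B) $w$ is weakly increasing; (C) $w$ is a weakly increasing word, except for a block of $b_1$ $1$s inserted between two distinct letters, where $x$ is the distinct letter immediately before this block of $1$s; (D) $w=uv$ where $u$ is a word consisting of $a_1$ $1$s and $a_2$ $2$s (in any order permitted for a restricted growth function) and $v=3^{b_3}4^{b_4}\cdots m^{b_m}$; $c$ is the position of the first $2$ in $u$, $d$ is the position of the last $2$ in $u$, and $f$ is the position of the last $1$ in $u$. If $m\le2$, then $ls(w)=n-l$; if moreover $w$ is weakly increasing, then $lb(w)=0$, $rb(w)=l$ and $rs(w)=0$; and if $w=1^iw'1^j2^k$, where $i,j\ge1$, $k\ge0$ and $w'$ begins and ends with $2$, then $lb(w)=l-i$, $rb(w)=l-\delta_{k,0}\,j$ and $rs(w)=n-l-k$. Otherwise, $$lb(w)=\begin{cases}0&\text{form (B)}\\(x-1)b_1&\text{form (C)}\\ a_1-c+1&\text{form (D)}\end{cases}\qquad rs(w)=\begin{cases}0&\text{form (B)}\\ \sum_{i=2}^x a_i&\text{form (C)}\\ f-a_1&\text{form (D)}\end{cases}$$ $$rb(w)=\begin{cases}l&\text{form (B)}\\ \sum_{i=1}^m(m-i)a_i+(m-x)b_1&\text{form (C)}\\ (d-a_2)(m-1)+(|u|-d)(m-2)+\sum_{i=2}^{m-1}(m-i)a_i&\text{form (D)}\end{cases}$$ $$ls(w)=\sum_{i=1}^m(i-1)a_i.$$ Here $|u|$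 is the length of $u$; in (B) and (D), $a_i$ is the number of $i$s in $w$ (so $a_i=b_i$ for $i\ge3$ in (D)); in (C), $a_i$ is the number of $i$s in the weakly increasing word before insertion of the block of $1$s.
   Context: A set partition $\sigma$ of $[n]=\{1,\dots,n\}$ is written $\sigma=B_1/B_2/\dots/B_m$ with blocks ordered so that $\min B_1<\dots<\min B_m$. To it corresponds the restricted growth function $w(\sigma)=w_1\cdots w_n$ with $w_i=j$ if $i\in B_j$. $\sigma$ contains a pattern $\pi$ (a set partition of $[k]$) if for some $A\subseteq[n]$ the partition of $A$ formed by the nonempty sets $A\cap B_i$, relabelled order-preservingly by $1,\dots,|A|$, equals $\pi$; otherwise it avoids $\pi$. $R_n(\pi)$ is the set of $w(\sigma)$ for $\sigma$ a set partition of $[n]$ avoiding $\pi$. The pattern $1/24/3$ is the set partition $\{1\},\{2,4\},\{3\}$ of $[4]$. Wachs and White statistics (counting distinct letter values): $rs(w)=\sum_i|\{w_j: j>i,\ w_j<w_i\}|$, $ls(w)=\sum_i|\{w_j: j<i,\ w_j<w_i\}|$, $lb(w)=\sum_i|\{w_j: j<i,\ w_j>w_i\}|$, $rb(w)=\sum_i|\{w_j: j>i,\ w_j>w_i\}|$. Positions within $u$ are numbered starting from $1$. $\delta_{k,0}$ is $1$ if $k=0$ and $0$ otherwise. An exponent on a letter denotes repetition.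
   Formalization: Corrected: in form (B) with m≥3, rb(w)=Σ(m−i)a_i instead of l (123 has rb=3, l=1); for m≤2 weakly increasing, rb(w)=l only if m=2, and 0 if m=1 (w=1); form (C) also allows the block of 1s at the end of the word (1231 fits no printed form). n≥1 is assumed. *)

theory Defs
  imports Main "HOL-Library.Disjoint_Sets"
begin

section \<open>Set partitions and restricted growth functions\<close>

text \<open>A set partition of \<open>[n]\<close> is a set \<open>P\<close> of blocks with \<^term>\<open>partition_on {1..n} P\<close>.
  When the blocks are listed by increasing minimum, the block \<open>B\<close> comes in position
  \<open>block_index P B\<close>, starting from 1.\<close>

definition block_index :: "nat set set \<Rightarrow> nat set \<Rightarrow> nat" where
  "block_index P B = card {C \<in> P. Min C \<le> Min B}"

definition rgf :: "nat \<Rightarrow> nat set set \<Rightarrow> nat list" where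
  "rgf n P = map (\<lambda>i. block_index P (THE B. B \<in> P \<and> i \<in> B)) [1..<n + 1]"

definition subpartition :: "nat set set \<Rightarrow> nat set \<Rightarrow> nat set set" where
  "subpartition P A = {A \<inter> B | B. B \<in> P} - {{}}"

text \<open>On a finite set \<open>A\<close>, the map sending \<open>x\<close> to the number of elements of \<open>A\<close> that are at most
  \<open>x\<close> is the order-preserving bijection onto \<open>{1..card A}\<close>.\<close>

definition standardize :: "nat set \<Rightarrow> nat set set \<Rightarrow> nat set set" where
  "standardize A Q = (\<lambda>B. (\<lambda>x. card {a \<in> A. a \<le> x}) ` B) ` Q"

definition contains_pattern :: "nat set set \<Rightarrow> nat set set \<Rightarrow> bool" where
  "contains_pattern P \<pi> \<longleftrightarrow> (\<exists>A \<subseteq> \<Union>P. standardize A (subpartition P A) = \<pi>)"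

definition R :: "nat \<Rightarrow> nat set set \<Rightarrow> nat list set" where
  "R n \<pi> = {rgf n P | P. partition_on {1..n} P \<and> \<not> contains_pattern P \<pi>}"

definition pat_1_24_3 :: "nat set set" where
  "pat_1_24_3 = {{1}, {2, 4}, {3}}"


section \<open>The statistics of Wachs and White\<close>

text \<open>The sets below consist of letter values, so a repeated letter is counted once.\<close>

definition ls :: "nat list \<Rightarrow> nat" where
  "ls w = (\<Sum>i<length w. card {w ! j | j. j < i \<and> w ! j < w ! i})"

definition lb :: "nat list \<Rightarrow> nat" where
  "lb w = (\<Sum>i<length w. card {w ! j | j. j < i \<and> w ! j > w ! i})"

definition rs :: "nat list \<Rightarrow> nat" where
  "rs w = (\<Sum>i<length w. card {w ! j | j. i < j \<and> j < length w \<and> w ! j < w ! i})"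

definition rb :: "nat list \<Rightarrow> nat" where
  "rb w = (\<Sum>i<length w. card {w ! j | j. i < j \<and> j < length w \<and> w ! j > w ! i})"


section \<open>Words\<close>

text \<open>Positions are numbered from 1, whereas \<open>(!)\<close> numbers them from 0.\<close>

definition first_pos :: "nat \<Rightarrow> nat list \<Rightarrow> nat" where
  "first_pos x u = Min {p \<in> {1..length u}. u ! (p - 1) = x}"

definition last_pos :: "nat \<Rightarrow> nat list \<Rightarrow> nat" where
  "last_pos x u = Max {p \<in> {1..length u}. u ! (p - 1) = x}"

text \<open>\<open>w\<close> arises from the weakly increasing word \<open>p @ q\<close> by inserting a block of \<open>b\<close> ones between
  two distinct letters. The letter before the block is \<^term>\<open>last p\<close>. The block may also be
  appended at the end of the word, as in \<open>1231\<close>, where no letter follows it.\<close>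

definition form_C :: "nat list \<Rightarrow> nat list \<Rightarrow> nat \<Rightarrow> nat list \<Rightarrow> bool" where
  "form_C w p b q \<longleftrightarrow>
     w = p @ replicate b 1 @ q \<and> 1 \<le> b \<and> sorted (p @ q) \<and> p \<noteq> [] \<and>
     (q = [] \<or> last p \<noteq> hd q)"

definition form_D :: "nat list \<Rightarrow> nat list \<Rightarrow> (nat \<Rightarrow> nat) \<Rightarrow> bool" where
  "form_D w u b \<longleftrightarrow>
     w = u @ concat (map (\<lambda>i. replicate (b i) i) [3..<Max (set w) + 1]) \<and> set u \<subseteq> {1, 2}"

end

theory Submission
  imports Defs "HOL-Library.Multiset"
begin

text \<open>A restricted growth function \<open>w\<close> avoids 1/24/3 iff it has no subword \<open>a b c b\<close> with \<open>a\<close>, \<open>b\<close>,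
  \<open>c\<close> distinct. If \<open>y > z \<ge> 2\<close> and \<open>z\<close> came after \<open>y\<close>, then \<open>w\<close> would contain \<open>1 z y z\<close>; so the smaller letter
  of every descent is 1. Let 3 occur in \<open>w\<close>, for the first time at position \<open>t\<close>. If no 1 follows \<open>t\<close>, this gives
  form (D). Otherwise the 1s after \<open>t\<close> are contiguous, since \<open>1 c 1\<close> there would be preceded by a letter
  2 or 3 different from \<open>c\<close>, and no 1 lies between a 2 and position \<open>t\<close>, since \<open>2 1 3 1\<close> is forbidden; this gives form (C).
  Each statistic is then a sum over the letters of \<open>w\<close>, evaluated segment by segment.\<close>

section \<open>The words of pattern-avoiding partitions\<close>

text \<open>Equivalent to the usual condition that the first letter is 1 and every later letter
  exceeds the maximum before it by at most 1. This form directly yields earlier occurrences of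
  smaller letters.\<close>

definition rgf_word :: "nat list \<Rightarrow> bool" where
  "rgf_word w \<longleftrightarrow>
     (\<forall>i < length w. 1 \<le> w ! i \<and> (\<forall>v. 1 \<le> v \<and> v < w ! i \<longrightarrow> (\<exists>j < i. w ! j = v)))"

definition avoids_1_24_3 :: "nat list \<Rightarrow> bool" where
  "avoids_1_24_3 w \<longleftrightarrow>
     \<not> (\<exists>i j k l. i < j \<and> j < k \<and> k < l \<and> l < length w \<and> w ! j = w ! l
          \<and> w ! i \<noteq> w ! j \<and> w ! k \<noteq> w ! j \<and> w ! i \<noteq> w ! k)"

section \<open>From set partitions to words\<close>

lemma inj_on_block_index:
  assumes P: "partition_on A P" and "finite A"
  shows "inj_on (block_index P) P"
proof (rule inj_onI)
  fix B C assume BC: "B \<in> P" "C \<in> P" and eq: "block_index P B = block_index P C"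
  have finP: "finite P"
    using assms finite_elements by blast
  have mem: "Min D \<in> D" if "D \<in> P" for D
    using that partition_onD1[OF P] partition_onD3[OF P] assms(2)
    by (intro Min_in) (auto intro: finite_subset)
  \<comment> \<open>The block \<open>C\<close> is counted in its own index but not in that of
    \<open>B\<close>, which has a smaller minimum.\<close>
  have sub: "{D \<in> P. Min D \<le> Min B} \<subset> {D \<in> P. Min D \<le> Min C}" if "Min B < Min C" "C \<in> P" for B C
    using that by force
  have lt: "block_index P B < block_index P C" if "Min B < Min C" "C \<in> P" for B C
    unfolding block_index_def by (rule psubset_card_mono[OF _ sub[OF that]]) (use finP in auto)
  \<comment> \<open>Equal indices thus force equal minima, and disjoint blocks cannot share a
    minimum.\<close>
  have "Min B = Min C"
    using lt[of B C] lt[of C B] eq BC by linarith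
  then show "B = C"
    using mem[OF BC(1)] mem[OF BC(2)] disjointD[OF partition_onD2[OF P] BC] by auto
qed

text \<open>An injection into a finite set of the same size is onto. Each index is at least 1
  because a block counts itself.\<close>

lemma block_index_image:
  assumes P: "partition_on A P" and "finite A"
  shows "block_index P ` P = {1..card P}"
proof (rule card_subset_eq)
  have finP: "finite P"
    using assms finite_elements by blast
  have "block_index P B \<in> {1..card P}" if "B \<in> P" for B
  proof -
    have "block_index P B \<le> card P"
      unfolding block_index_def by (rule card_mono) (use finP in auto)
    moreover have "card {B} \<le> block_index P B"
      unfolding block_index_def by (rule card_mono) (use finP that in auto)
    ultimately show ?thesis by simp
  qed
  then show "block_index P ` P \<subseteq> {1..card P}" by blast
  show "card (block_index P ` P) = card {1..card P}"
    using card_image[OF inj_on_block_index[OF assms]] by simp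
qed auto

lemma block_index_less_imp:
  assumes "finite P" "block_index P C < block_index P B"
  shows "Min C < Min B"
proof (rule ccontr)
  assume "\<not> Min C < Min B"
  then have "block_index P B \<le> block_index P C"
    unfolding block_index_def using assms(1) by (intro card_mono) auto
  then show False using assms(2) by simp
qed

text \<open>A value \<open>v\<close> below the letter of the block \<open>B\<close> is the index of
  a block \<open>C\<close> with smaller minimum, so the element \<open>Min C\<close> precedes every
  element of \<open>B\<close> and carries the letter \<open>v\<close>.\<close>

lemma rgf_word_rgf:
  assumes P: "partition_on {1..n} P"
  shows "rgf_word (rgf n P)"
  unfolding rgf_word_def
proof (intro allI impI conjI)
  have finP: "finite P"
    using P finite_elements by blast
  have blk: "(THE B. B \<in> P \<and> x \<in> B) = B" if "B \<in> P" "x \<in> B" for x B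
    using that disjointD[OF partition_onD2[OF P]] by (intro the_equality) blast+
  \<comment> \<open>List index \<open>i\<close> holds the letter of the element
    \<open>Suc i\<close>.\<close>
  have nth: "rgf n P ! i = block_index P B" if "B \<in> P" "Suc i \<in> B" "i < n" for i B
    using that blk[OF that(1,2)] by (simp add: rgf_def del: upt_Suc)
  fix i assume "i < length (rgf n P)"
  then have i: "i < n" by (simp add: rgf_def del: upt_Suc)
  then have "Suc i \<in> \<Union>P" using partition_onD1[OF P] by auto
  then obtain B where B: "B \<in> P" "Suc i \<in> B" by blast
  have val: "rgf n P ! i \<in> {1..card P}"
    using nth[OF B i] B(1) block_index_image[OF P] by auto
  then show "1 \<le> rgf n P ! i" by simp
  fix v assume v: "1 \<le> v \<and> v < rgf n P ! i"
  then have "v \<in> block_index P ` P"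
    using val block_index_image[OF P] by auto
  then obtain C where C: "C \<in> P" "block_index P C = v" by blast
  have sub: "D \<subseteq> {1..n}" if "D \<in> P" for D
    using that partition_onD1[OF P] by blast
  have finC: "finite C" and finB: "finite B"
    using sub C(1) B(1) by (auto intro: finite_subset)
  have "C \<noteq> {}" using C(1) partition_onD3[OF P] by blast
  then have "Min C \<in> C" using finC by simp
  have "Min C < Min B"
    using block_index_less_imp[OF finP] C(2) v nth[OF B i] by simp
  also have "Min B \<le> Suc i" using B(2) finB by simp
  finally have lt: "Min C < Suc i" .
  have "1 \<le> Min C" "Min C \<le> n" using sub[OF C(1)] \<open>Min C \<in> C\<close> by auto
  then have "rgf n P ! (Min C - 1) = v"
    using nth[of C "Min C - 1"] C \<open>Min C \<in> C\<close> by auto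
  then show "\<exists>j<i. rgf n P ! j = v"
    using lt \<open>1 \<le> Min C\<close> by (intro exI[of _ "Min C - 1"]) auto
qed

text \<open>A subword \<open>a b c b\<close> selects four elements of \<open>{1..n}\<close>, and the
  partition they induce standardizes to the pattern.\<close>

lemma avoids_rgf:
  assumes P: "partition_on {1..n} P" and av: "\<not> contains_pattern P pat_1_24_3"
  shows "avoids_1_24_3 (rgf n P)"
  unfolding avoids_1_24_3_def
proof (rule notI, elim exE conjE)
  have blk: "(THE B. B \<in> P \<and> x \<in> B) = B" if "B \<in> P" "x \<in> B" for x B
    using that disjointD[OF partition_onD2[OF P]] by (intro the_equality) blast+
  have nth: "rgf n P ! i = block_index P B" if "B \<in> P" "Suc i \<in> B" "i < n" for i B
    using that blk[OF that(1,2)] by (simp add: rgf_def del: upt_Suc)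
  have ex: "\<exists>B\<in>P. Suc i \<in> B" if "i < n" for i
  proof -
    have "Suc i \<in> \<Union>P" using that partition_onD1[OF P] by auto
    then show ?thesis by blast
  qed
  fix i' j' k' l'
  assume ord: "i' < j'" "j' < k'" "k' < l'" and len: "l' < length (rgf n P)"
    and w: "rgf n P ! j' = rgf n P ! l'" "rgf n P ! i' \<noteq> rgf n P ! j'"
      "rgf n P ! k' \<noteq> rgf n P ! j'" "rgf n P ! i' \<noteq> rgf n P ! k'"
  have "l' < n" using len by (simp add: rgf_def del: upt_Suc)
  \<comment> \<open>Passage from list indices, counted from 0, to elements of
    \<open>{1..n}\<close>.\<close>
  define i j k l where ijkl: "i = Suc i'" "j = Suc j'" "k = Suc k'" "l = Suc l'"
  obtain Bi Bj Bk Bl where B: "Bi \<in> P" "i \<in> Bi" "Bj \<in> P" "j \<in> Bj" "Bk \<in> P" "k \<in> Bk" "Bl \<in> P" "l \<in> Bl"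
    using ex[of i'] ex[of j'] ex[of k'] ex[of l'] ord \<open>l' < n\<close> ijkl by auto
  have idx: "rgf n P ! i' = block_index P Bi" "rgf n P ! j' = block_index P Bj"
    "rgf n P ! k' = block_index P Bk" "rgf n P ! l' = block_index P Bl"
    using nth B ord \<open>l' < n\<close> ijkl by auto
  have "Bl = Bj"
    using inj_on_block_index[OF P] w(1) idx B by (auto dest: inj_onD)
  have ne: "Bi \<noteq> Bj" "Bk \<noteq> Bj" "Bi \<noteq> Bk" using w idx by auto
  have uniq: "C = D" if "C \<in> P" "D \<in> P" "x \<in> C" "x \<in> D" for C D x
    using that disjointD[OF partition_onD2[OF P]] by blast
  have lt: "i < j" "j < k" "k < l" using ord ijkl by auto
  define A where "A = {i, j, k, l}"
  have AB: "A \<inter> Bi = {i}" "A \<inter> Bj = {j, l}" "A \<inter> Bk = {k}"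
    using B \<open>Bl = Bj\<close> ne uniq[OF B(1,3)] uniq[OF B(1,5)] uniq[OF B(3,5)] by (auto simp: A_def)
  have "subpartition P A = {{i}, {j, l}, {k}}"
  proof
    show "subpartition P A \<subseteq> {{i}, {j, l}, {k}}"
    proof
      fix X assume "X \<in> subpartition P A"
      then obtain D where D: "D \<in> P" "X = A \<inter> D" "A \<inter> D \<noteq> {}"
        by (auto simp: subpartition_def)
      then have "D = Bi \<or> D = Bj \<or> D = Bk"
        using B \<open>Bl = Bj\<close> uniq[OF D(1) B(1)] uniq[OF D(1) B(3)] uniq[OF D(1) B(5)] by (auto simp: A_def)
      then show "X \<in> {{i}, {j, l}, {k}}" unfolding D(2) by (elim disjE) (simp_all add: AB)
    qed
    have "{A \<inter> Bi, A \<inter> Bj, A \<inter> Bk} \<subseteq> {A \<inter> B | B. B \<in> P}" using B by blast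
    then show "{{i}, {j, l}, {k}} \<subseteq> subpartition P A"
      unfolding subpartition_def AB by auto
  qed
  \<comment> \<open>The ranks within \<open>A\<close> are the new labels, so \<open>{j, l}\<close>
    becomes the block \<open>{2, 4}\<close>.\<close>
  moreover have "card {a \<in> A. a \<le> i} = 1" "card {a \<in> A. a \<le> j} = 2"
    "card {a \<in> A. a \<le> k} = 3" "card {a \<in> A. a \<le> l} = 4"
  proof -
    have "{a \<in> A. a \<le> i} = {i}" "{a \<in> A. a \<le> j} = {i, j}"
      "{a \<in> A. a \<le> k} = {i, j, k}" "{a \<in> A. a \<le> l} = {i, j, k, l}"
      using lt by (auto simp: A_def)
    then show "card {a \<in> A. a \<le> i} = 1" "card {a \<in> A. a \<le> j} = 2"
      "card {a \<in> A. a \<le> k} = 3" "card {a \<in> A. a \<le> l} = 4"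
      using lt by auto
  qed
  ultimately have "standardize A (subpartition P A) = pat_1_24_3"
    by (simp add: standardize_def pat_1_24_3_def insert_commute)
  moreover have "A \<subseteq> \<Union>P" using B by (auto simp: A_def)
  ultimately show False using av unfolding contains_pattern_def by blast
qed

lemma rgf_word_R: "w \<in> R n \<pi> \<Longrightarrow> rgf_word w"
  by (auto simp: R_def rgf_word_rgf)

lemma avoids_R: "w \<in> R n pat_1_24_3 \<Longrightarrow> avoids_1_24_3 w"
  by (auto simp: R_def avoids_rgf)

lemma length_R: "w \<in> R n \<pi> \<Longrightarrow> length w = n"
  by (auto simp: R_def rgf_def simp del: upt_Suc)

section \<open>Recursions for the statistics\<close>

lemma sum_lessThan_Suc_Cons: "(\<Sum>i<length (x # w). F i) = F 0 + (\<Sum>i<length w. F (Suc i))"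
  for F :: "nat \<Rightarrow> nat"
  by (simp add: sum.lessThan_Suc_shift del: sum.lessThan_Suc)

text \<open>With \<open>Q\<close> abstract, one recursion serves both statistics that look to the
  right: the head sees all of \<open>w\<close>, and every later position is merely shifted.\<close>

lemma letters_after_Cons: "{(x # w) ! j | j. i < j \<and> j < length (x # w) \<and> Q ((x # w) ! j)}
    = (case i of 0 \<Rightarrow> {y \<in> set w. Q y} | Suc i \<Rightarrow> {w ! j | j. i < j \<and> j < length w \<and> Q (w ! j)})"
proof (cases i)
  case 0
  have "{(x # w) ! j | j. 0 < j \<and> j < length (x # w) \<and> Q ((x # w) ! j)}
      = {w ! j | j. j < length w \<and> Q (w ! j)}"
    by (force simp: gr0_conv_Suc)
  then show ?thesis using 0 by (auto simp: in_set_conv_nth)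
next
  case (Suc k)
  have "{(x # w) ! j | j. Suc k < j \<and> j < length (x # w) \<and> Q ((x # w) ! j)}
      = {w ! j | j. k < j \<and> j < length w \<and> Q (w ! j)}"
    by (force simp: Suc_less_eq2)
  then show ?thesis using Suc by simp
qed

lemma rb_Nil [simp]: "rb [] = 0"
  by (simp add: rb_def)

lemma rs_Nil [simp]: "rs [] = 0"
  by (simp add: rs_def)

lemma lb_Nil [simp]: "lb [] = 0"
  by (simp add: lb_def)

lemma ls_Nil [simp]: "ls [] = 0"
  by (simp add: ls_def)

lemma rb_Cons: "rb (x # w) = card {y \<in> set w. x < y} + rb w"
  unfolding rb_def sum_lessThan_Suc_Cons letters_after_Cons[where Q = "\<lambda>y. _ < y"] by simp

lemma rs_Cons: "rs (x # w) = card {y \<in> set w. y < x} + rs w"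
  unfolding rs_def sum_lessThan_Suc_Cons letters_after_Cons[where Q = "\<lambda>y. y < _"] by simp

text \<open>A letter appended at the end is invisible to positions that look to the left, so
  \<open>lb\<close> and \<open>ls\<close> recurse from the right end of the word.\<close>

lemma letters_before_snoc:
  assumes "i < length w"
  shows "{(w @ [x]) ! j | j. j < i \<and> Q ((w @ [x]) ! j)} = {w ! j | j. j < i \<and> Q (w ! j)}"
proof -
  have "(w @ [x]) ! j = w ! j" if "j < i" for j
    using that assms by (simp add: nth_append)
  then show ?thesis by (intro Collect_cong) (metis (no_types, lifting))
qed

lemma letters_before_length:
  "{(w @ [x]) ! j | j. j < length w \<and> Q ((w @ [x]) ! j)} = {y \<in> set w. Q y}"
proof -
  have "{(w @ [x]) ! j | j. j < length w \<and> Q ((w @ [x]) ! j)} = {w ! j | j. j < length w \<and> Q (w ! j)}"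
    by (intro Collect_cong) (metis (no_types, lifting) nth_append)
  then show ?thesis by (auto simp: in_set_conv_nth)
qed

lemma lb_snoc: "lb (w @ [x]) = lb w + card {y \<in> set w. x < y}"
proof -
  have "(\<Sum>i<length w. card {(w @ [x]) ! j | j. j < i \<and> (w @ [x]) ! i < (w @ [x]) ! j}) = lb w"
    unfolding lb_def by (rule sum.cong) (simp_all add: letters_before_snoc[where Q = "\<lambda>y. _ < y"] nth_append_left)
  then show ?thesis by (simp add: lb_def letters_before_length[where Q = "\<lambda>y. _ < y"])
qed

lemma ls_snoc: "ls (w @ [x]) = ls w + card {y \<in> set w. y < x}"
proof -
  have "(\<Sum>i<length w. card {(w @ [x]) ! j | j. j < i \<and> (w @ [x]) ! j < (w @ [x]) ! i}) = ls w"
    unfolding ls_def by (rule sum.cong) (simp_all add: letters_before_snoc[where Q = "\<lambda>y. y < _"] nth_append_left)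
  then show ?thesis by (simp add: ls_def letters_before_length[where Q = "\<lambda>y. y < _"])
qed

text \<open>Used to evaluate one segment at a time: as soon as the contribution of an occurrence in
  \<open>u\<close> depends only on its letter, the segment contributes a plain sum of
  \<open>g\<close>. The three lemmas that follow treat the other statistics in the same way, with
  the roles of prefix and suffix exchanged for \<open>lb\<close> and \<open>ls\<close>.\<close>

lemma rb_append_map:
  assumes "\<And>a x b. u = a @ x # b \<Longrightarrow> card {y \<in> set b \<union> set v. x < y} = g x"
  shows "rb (u @ v) = sum_list (map g u) + rb v"
  using assms
proof (induction u)
  case (Cons z u)
  have "card {y \<in> set u \<union> set v. z < y} = g z" using Cons.prems[of "[]"] by simp
  moreover have "rb (u @ v) = sum_list (map g u) + rb v"
    by (rule Cons.IH) (rule Cons.prems[of "z # _"], simp)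
  ultimately show ?case by (simp add: rb_Cons)
qed simp

lemma rs_append_map:
  assumes "\<And>a x b. u = a @ x # b \<Longrightarrow> card {y \<in> set b \<union> set v. y < x} = g x"
  shows "rs (u @ v) = sum_list (map g u) + rs v"
  using assms
proof (induction u)
  case (Cons z u)
  have "card {y \<in> set u \<union> set v. y < z} = g z" using Cons.prems[of "[]"] by simp
  moreover have "rs (u @ v) = sum_list (map g u) + rs v"
    by (rule Cons.IH) (rule Cons.prems[of "z # _"], simp)
  ultimately show ?case by (simp add: rs_Cons)
qed simp

lemma lb_append_map:
  assumes "\<And>a x b. v = a @ x # b \<Longrightarrow> card {y \<in> set u \<union> set a. x < y} = g x"
  shows "lb (u @ v) = lb u + sum_list (map g v)"
  using assms
proof (induction v rule: rev_induct)
  case (snoc z v)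
  have "card {y \<in> set u \<union> set v. z < y} = g z" using snoc.prems[of v z "[]"] by simp
  moreover have "lb (u @ v) = lb u + sum_list (map g v)"
    by (rule snoc.IH) (rule snoc.prems[of _ _ "_ @ [z]"], simp)
  ultimately show ?case by (simp add: lb_snoc flip: append_assoc)
qed simp

lemma ls_append_map:
  assumes "\<And>a x b. v = a @ x # b \<Longrightarrow> card {y \<in> set u \<union> set a. y < x} = g x"
  shows "ls (u @ v) = ls u + sum_list (map g v)"
  using assms
proof (induction v rule: rev_induct)
  case (snoc z v)
  have "card {y \<in> set u \<union> set v. y < z} = g z" using snoc.prems[of v z "[]"] by simp
  moreover have "ls (u @ v) = ls u + sum_list (map g v)"
    by (rule snoc.IH) (rule snoc.prems[of _ _ "_ @ [z]"], simp)
  ultimately show ?case by (simp add: ls_snoc flip: append_assoc)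
qed simp

section \<open>Restricted growth functions and two-letter words\<close>

lemma rgf_word_nth_smaller:
  "rgf_word w \<Longrightarrow> i < length w \<Longrightarrow> 1 \<le> v \<Longrightarrow> v < w ! i \<Longrightarrow> \<exists>j<i. w ! j = v"
  by (auto simp: rgf_word_def)

lemma rgf_word_ge_1: "rgf_word w \<Longrightarrow> x \<in> set w \<Longrightarrow> 1 \<le> x"
  by (auto simp: rgf_word_def in_set_conv_nth)

lemma rgf_word_before:
  assumes "rgf_word (a @ x # b)" "1 \<le> v" "v < x"
  shows "v \<in> set a"
proof -
  obtain j where "j < length a" "(a @ x # b) ! j = v"
    using rgf_word_nth_smaller[OF assms(1), of "length a" v] assms(2,3) by auto
  then show ?thesis by (auto simp: nth_append)
qed

lemma rgf_word_prefix:
  assumes "rgf_word (u @ v)"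
  shows "rgf_word u"
  unfolding rgf_word_def
proof (intro allI impI conjI)
  fix i assume i: "i < length u"
  then show "1 \<le> u ! i" using rgf_word_ge_1[OF assms] by simp
  fix x assume "1 \<le> x \<and> x < u ! i"
  then obtain j where "j < i" "(u @ v) ! j = x"
    using rgf_word_nth_smaller[OF assms, of i x] i by (auto simp: nth_append)
  then show "\<exists>j<i. u ! j = x" using i by (auto simp: nth_append)
qed

text \<open>Growth places all smaller positive values before an occurrence of the maximum.\<close>

lemma set_rgf_word:
  assumes "rgf_word w" "w \<noteq> []"
  shows "set w = {1..Max (set w)}"
proof
  show "set w \<subseteq> {1..Max (set w)}"
    using rgf_word_ge_1[OF assms(1)] by auto
  show "{1..Max (set w)} \<subseteq> set w"
  proof
    fix v assume v: "v \<in> {1..Max (set w)}"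
    have "Max (set w) \<in> set w" using assms(2) by simp
    then obtain a b where w: "w = a @ Max (set w) # b" by (meson split_list)
    show "v \<in> set w"
    proof (cases "v = Max (set w)")
      case True then show ?thesis using \<open>Max (set w) \<in> set w\<close> by simp
    next
      case False
      have "v \<in> set a"
        by (rule rgf_word_before[of a "Max (set w)" b]) (use False v w assms(1) in auto)
      then show ?thesis using w by (metis UnCI set_append)
    qed
  qed
qed

text \<open>By growth, the smaller values seen to the left of a letter \<open>x\<close> are exactly
  \<open>1, ..., x - 1\<close>. This is why the formula for \<open>ls\<close> is the same in all
  forms.\<close>

lemma ls_rgf_word:
  assumes "rgf_word w"
  shows "ls w = sum_list (map (\<lambda>x. x - 1) w)"
proof -
  have "card {y \<in> set [] \<union> set a. y < x} = x - 1" if "w = a @ x # b" for a x b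
  proof -
    have "{1..<x} \<subseteq> set a" using rgf_word_before[of a x b] assms that by auto
    moreover have "\<forall>y \<in> set a. 1 \<le> y" using rgf_word_ge_1[OF assms] that by simp
    ultimately have "{y \<in> set a. y < x} = {1..<x}" by auto
    then show ?thesis by simp
  qed
  from ls_append_map[of w "[]", OF this] show ?thesis by simp
qed

section \<open>Sorted words and concatenations\<close>

lemma rb_sorted:
  assumes "sorted v" "set v = {k..m}"
  shows "rb v = sum_list (map (\<lambda>x. m - x) v)"
proof -
  have "card {y \<in> set b \<union> set []. x < y} = m - x" if v: "v = a @ x # b" for a x b
  proof -
    have "y \<in> set b" if "x < y" "y \<le> m" for y
    proof -
      have "x \<in> {k..m}" unfolding assms(2)[symmetric] v by simp
      then have "y \<in> set v" using that assms(2) by auto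
      then show ?thesis using that assms(1) v by (auto simp: sorted_append)
    qed
    moreover have "set b \<subseteq> {..m}" using assms(2) v by auto
    ultimately have "{y \<in> set b. x < y} = {x<..m}" by auto
    then show ?thesis by simp
  qed
  from rb_append_map[of v "[]", OF this] show ?thesis by simp
qed

lemma lb_append_sorted:
  assumes "sorted v" "\<And>x y. x \<in> set u \<Longrightarrow> y \<in> set v \<Longrightarrow> x \<le> y"
  shows "lb (u @ v) = lb u"
proof -
  have "card {y \<in> set u \<union> set a. x < y} = 0" if "v = a @ x # b" for a x b
    using assms that by (fastforce simp: sorted_append)
  from lb_append_map[of v u, OF this] show ?thesis by simp
qed

lemma lb_sorted: "sorted v \<Longrightarrow> lb v = 0"
  using lb_append_sorted[of v "[]"] by simp

lemma rs_append_sorted: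
  assumes "sorted u" "\<And>x y. x \<in> set u \<Longrightarrow> y \<in> set v \<Longrightarrow> x \<le> y"
  shows "rs (u @ v) = rs v"
proof -
  have "card {y \<in> set b \<union> set v. y < x} = 0" if "u = a @ x # b" for a x b
    using assms that by (fastforce simp: sorted_append)
  from rs_append_map[of u v, OF this] show ?thesis by simp
qed

lemma rs_sorted: "sorted v \<Longrightarrow> rs v = 0"
  using rs_append_sorted[of v "[]"] by simp

lemma rs_append_less:
  assumes "\<And>x y. x \<in> set u \<Longrightarrow> y \<in> set v \<Longrightarrow> x < y"
  shows "rs (u @ v) = rs u + rs v"
  using assms
proof (induction u)
  case (Cons x u)
  have "{y \<in> set u \<union> set v. y < x} = {y \<in> set u. y < x}"
    using Cons.prems by fastforce
  then show ?case using Cons by (simp add: rs_Cons)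
qed simp

text \<open>Each letter of \<open>u\<close> sees, besides the larger letters within
  \<open>u\<close>, every distinct letter of \<open>v\<close>.\<close>

lemma rb_append_less:
  assumes "\<And>x y. x \<in> set u \<Longrightarrow> y \<in> set v \<Longrightarrow> x < y"
  shows "rb (u @ v) = rb u + length u * card (set v) + rb v"
  using assms
proof (induction u)
  case (Cons x u)
  have "{y \<in> set u \<union> set v. x < y} = {y \<in> set u. x < y} \<union> set v"
    using Cons.prems by auto
  moreover have "card ({y \<in> set u. x < y} \<union> set v) = card {y \<in> set u. x < y} + card (set v)"
    by (rule card_Un_disjoint) (use Cons.prems in fastforce)+
  ultimately show ?case using Cons by (simp add: rb_Cons)
qed simp

section \<open>Two-letter words\<close>

lemma sum_list_indicator: "sum_list (map (\<lambda>y. if y = x then 1 else 0) w) = count_list w x"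
  by (induction w) auto

lemma count_list_replicate_if: "count_list (replicate k x) y = (if x = y then k else 0)"
  by (induction k) auto

text \<open>The displayed 2 is the first one. Every 1 after it sees the single larger value 2, and
  no other letter sees a larger one to its left.\<close>

lemma lb_binary:
  assumes "set ys \<subseteq> {1}" "set zs \<subseteq> {1, 2}"
  shows "lb (ys @ 2 # zs) = count_list zs 1"
proof -
  have "card {z \<in> set (ys @ [2]) \<union> set a. y < z} = (if y = 1 then 1 else 0)" if "zs = a @ y # c" for a y c
  proof -
    have "{z \<in> set (ys @ [2]) \<union> set a. y < z} = (if y = 1 then {2} else {})"
      using assms that by auto
    then show ?thesis by simp
  qed
  from lb_append_map[of zs "ys @ [2]", OF this]
  have "lb (ys @ 2 # zs) = lb (ys @ [2]) + count_list zs 1"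
    by (simp add: sum_list_indicator)
  moreover have "sorted (ys @ [2])"
    using assms(1) by (induction ys) auto
  ultimately show ?thesis by (simp add: lb_sorted)
qed

lemma sorted_constant: "set zs \<subseteq> {x} \<Longrightarrow> sorted zs" for x :: "'a :: linorder"
  by (induction zs) auto

text \<open>The displayed 1 is the last one, so exactly the 2s before it have a smaller value to
  their right.\<close>

lemma rs_binary:
  assumes "set ys \<subseteq> {1, 2}" "set zs \<subseteq> {2}"
  shows "rs (ys @ 1 # zs) = count_list ys 2"
proof -
  have "card {z \<in> set c \<union> set (1 # zs). z < y} = (if y = 2 then 1 else 0)" if "ys = a @ y # c" for a y c
  proof -
    have "{z \<in> set c \<union> set (1 # zs). z < y} = (if y = 2 then {1} else {})"
      using assms that by auto
    then show ?thesis by simp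
  qed
  from rs_append_map[of ys "1 # zs", OF this]
  have "rs (ys @ 1 # zs) = count_list ys 2 + rs (1 # zs)"
    by (simp add: sum_list_indicator)
  moreover have "sorted (1 # zs)"
    using assms(2) sorted_constant[of zs 2] by auto
  ultimately show ?thesis by (simp add: rs_sorted del: sorted_simps)
qed

text \<open>The displayed 2 is the last one, so exactly the 1s before it have a larger value to
  their right.\<close>

lemma rb_binary:
  assumes "set ys \<subseteq> {1, 2}" "set zs \<subseteq> {1}"
  shows "rb (ys @ 2 # zs) = count_list ys 1"
proof -
  have "card {z \<in> set c \<union> set (2 # zs). y < z} = (if y = 1 then 1 else 0)" if "ys = a @ y # c" for a y c
  proof -
    have "{z \<in> set c \<union> set (2 # zs). y < z} = (if y = 1 then {2} else {})"
      using assms that by auto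
    then show ?thesis by simp
  qed
  from rb_append_map[of ys "2 # zs", OF this]
  have "rb (ys @ 2 # zs) = count_list ys 1 + rb (2 # zs)"
    by (simp add: sum_list_indicator)
  moreover have "card {z \<in> set c \<union> set []. y < z} = 0" if "2 # zs = a @ y # c" for a y c
    using assms(2) that by (cases a) auto
  from rb_append_map[of "2 # zs" "[]", OF this] have "rb (2 # zs) = 0" by simp
  ultimately show ?thesis by simp
qed

lemma length_binary:
  "set w \<subseteq> {1, 2} \<Longrightarrow> length w = count_list w 1 + count_list w (2::nat)"
  by (induction w) auto

section \<open>Positions and sums grouped by letter value\<close>

lemma first_pos_append: "x \<notin> set ys \<Longrightarrow> first_pos x (ys @ x # zs) = length ys + 1"
  unfolding first_pos_def
  by (rule Min_eqI) (auto simp: nth_append split: if_splits)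

lemma last_pos_append:
  assumes "x \<notin> set zs"
  shows "last_pos x (ys @ x # zs) = length ys + 1"
  unfolding last_pos_def
proof (rule Max_eqI)
  fix p assume "p \<in> {p \<in> {1..length (ys @ x # zs)}. (ys @ x # zs) ! (p - 1) = x}"
  then have p: "p - 1 < length (ys @ x # zs)" "(ys @ x # zs) ! (p - 1) = x" by auto
  show "p \<le> length ys + 1"
  proof (rule ccontr)
    assume *: "\<not> p \<le> length ys + 1"
    then obtain r where r: "p = length ys + 2 + r"
      by (metis add.assoc add_2_eq_Suc' Suc_eq_plus1 le_Suc_ex not_less_eq_eq)
    then have "zs ! r = x" "r < length zs"
      using p by (auto simp: nth_append)
    then show False using assms nth_mem by blast
  qed
qed auto

text \<open>Grouping equal letters turns the sum over positions into a sum over values. As no value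
  exceeds \<open>m\<close>, truncated and integer subtraction agree.\<close>

lemma sum_list_weight:
  assumes "set w \<subseteq> {k..m}"
  shows "int (sum_list (map (\<lambda>x. m - x) w)) = (\<Sum>i=k..m. (int m - int i) * int (count_list w i))"
proof -
  have "int (sum_list (map (\<lambda>x. m - x) w)) = (\<Sum>i=k..m. int (count_list w i * (m - i)))"
    using sum_list_map_eq_sum_count2[OF assms, of "\<lambda>x. m - x"] by (simp del: of_nat_mult)
  also have "\<dots> = (\<Sum>i=k..m. (int m - int i) * int (count_list w i))"
    by (rule sum.cong) (auto simp: of_nat_diff)
  finally show ?thesis .
qed

lemma ls_rgf_word_sum:
  assumes "rgf_word w" "w \<noteq> []" "m = Max (set w)"
  shows "int (ls w) = (\<Sum>i=1..m. (int i - 1) * int (count_list w i))"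
proof -
  have "int (ls w) = (\<Sum>i=1..m. int (count_list w i * (i - 1)))"
    using sum_list_map_eq_sum_count2[of w "{1..m}" "\<lambda>x. x - 1"] set_rgf_word[OF assms(1,2)] assms(3)
    by (simp add: ls_rgf_word[OF assms(1)] del: of_nat_mult)
  also have "\<dots> = (\<Sum>i=1..m. (int i - 1) * int (count_list w i))"
    by (rule sum.cong) (auto simp: of_nat_diff)
  finally show ?thesis .
qed

section \<open>Words avoiding 1/24/3\<close>

lemma sorted_concat_replicate:
  "sorted (concat (map (\<lambda>i. replicate (b i) i) [k..<n]))"
proof (induction n)
  case (Suc n)
  have "\<forall>x \<in> set (concat (map (\<lambda>i. replicate (b i) i) [k..<n])). x \<le> n" by auto
  then show ?case using Suc by (auto simp: sorted_append)
qed simp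

lemma count_list_concat_replicate:
  "count_list (concat (map (\<lambda>i. replicate (b i) i) [k..<n])) j = (if k \<le> j \<and> j < n then b j else 0)"
  by (induction n) (auto simp: count_list_replicate_if)

text \<open>A sorted list is determined by its multiset, so it suffices to compare multiplicities.
  This supplies the exponents \<open>b_i\<close> of form (D).\<close>

lemma sorted_eq_concat_replicate:
  assumes "sorted v" "set v \<subseteq> {k..<n}"
  shows "v = concat (map (\<lambda>i. replicate (count_list v i) i) [k..<n])" (is "v = ?c")
proof -
  have "mset v = mset ?c"
  proof (rule multiset_eqI)
    fix j show "count (mset v) j = count (mset ?c) j"
      unfolding count_mset count_list_concat_replicate using assms(2) by (auto intro!: count_notin)
  qed
  from properties_for_sort[OF this assms(1)] show ?thesis
    unfolding sorted_sort_id[OF sorted_concat_replicate] by (rule sym)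
qed

section \<open>Classification of the avoiding words\<close>

lemma avoids_1_24_3D:
  "avoids_1_24_3 w \<Longrightarrow> i < j \<Longrightarrow> j < k \<Longrightarrow> k < l \<Longrightarrow> l < length w \<Longrightarrow> w ! j = w ! l \<Longrightarrow>
    w ! i \<noteq> w ! j \<Longrightarrow> w ! k \<noteq> w ! j \<Longrightarrow> w ! i = w ! k"
  unfolding avoids_1_24_3_def by blast

lemma avoids_descent_eq_1:
  assumes rgf: "rgf_word w" and av: "avoids_1_24_3 w"
    and jk: "j < k" "k < length w" "w ! k < w ! j"
  shows "w ! k = 1"
proof (rule ccontr)
  assume ne: "w ! k \<noteq> 1"
  moreover have "1 \<le> w ! k" using rgf jk by (simp add: rgf_word_def)
  ultimately have "1 < w ! k" by simp
  \<comment> \<open>Growth gives a copy of \<open>w ! k\<close> before the larger letter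
    \<open>w ! j\<close>, and a 1 before that copy; the forbidden subword sits at positions
    \<open>h < i < j < k\<close>.\<close>
  obtain i where i: "i < j" "w ! i = w ! k"
    using rgf_word_nth_smaller[OF rgf, of j "w ! k"] jk \<open>1 < w ! k\<close> by auto
  obtain h where h: "h < i" "w ! h = 1"
    using rgf_word_nth_smaller[OF rgf, of i 1] i jk \<open>1 < w ! k\<close> by auto
  have "w ! h = w ! j"
    by (rule avoids_1_24_3D[OF av h(1) i(1) jk(1,2)]) (use i h jk ne in auto)
  then show False using h(2) jk(3) \<open>1 < w ! k\<close> by simp
qed

text \<open>Weakly increasing words with a letter above 2 fall under form (D), since no 1 follows
  their first 3.\<close>

lemma avoids_1_24_3_cases:
  assumes rgf: "rgf_word w" and av: "avoids_1_24_3 w" and "w \<noteq> []" and m: "2 < Max (set w)"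
  shows "(\<exists>p b q. form_C w p b q) \<or> (\<exists>u b. form_D w u b)"
proof -
  define m where "m = Max (set w)"
  have "set w = {1..m}"
    using set_rgf_word[OF rgf \<open>w \<noteq> []\<close>] by (simp add: m_def)
  moreover have "3 \<le> m" using m by (simp add: m_def)
  ultimately have "3 \<in> set w" by simp
  then have "\<exists>t. t < length w \<and> w ! t = 3" by (auto simp: in_set_conv_nth)
  then obtain t where t: "t < length w" "w ! t = 3" and "\<forall>i<t. \<not> (i < length w \<and> w ! i = 3)"
    using exists_least_iff[of "\<lambda>t. t < length w \<and> w ! t = 3"] by blast
  then have t_min: "\<And>i. i < t \<Longrightarrow> w ! i \<noteq> 3" by simp
  \<comment> \<open>A letter above 3 would require a 3 before it, contradicting the minimality of
    \<open>t\<close>.\<close>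
  have before: "w ! i \<in> {1, 2}" if "i < t" for i
  proof -
    have "1 \<le> w ! i" using rgf that t by (simp add: rgf_word_def)
    moreover have "\<not> 3 < w ! i"
      using rgf_word_nth_smaller[OF rgf, of i 3] t_min that t(1) by fastforce
    ultimately show ?thesis using t_min[OF that] by auto
  qed
  obtain i2 where i2: "i2 < t" "w ! i2 = 2"
    using rgf_word_nth_smaller[OF rgf t(1), of 2] t(2) by auto
  show ?thesis
  proof (cases "\<exists>g. t < g \<and> g < length w \<and> w ! g = 1")
    case False
    define u v where "u = take t w" and "v = drop t w"
    have w: "w = u @ v" by (simp add: u_def v_def)
    \<comment> \<open>Any descent ends in a 1, and no 1 occurs from the first 3 on.\<close>
    have v_mono: "w ! j \<le> w ! k" if "t \<le> j" "j < k" "k < length w" for j k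
      using avoids_descent_eq_1[OF rgf av that(2,3)] False that by force
    have "set u \<subseteq> {1, 2}"
    proof
      fix y assume "y \<in> set u"
      then obtain i where "i < t" "w ! i = y" by (auto simp: u_def in_set_conv_nth)
      then show "y \<in> {1, 2}" using before[of i] by simp
    qed
    moreover have sv: "sorted v"
      unfolding sorted_iff_nth_mono_less using v_mono by (simp add: v_def)
    moreover have "set v \<subseteq> {3..<m + 1}"
    proof
      fix y assume y: "y \<in> set v"
      then obtain i where "i < length v" "v ! i = y" by (auto simp: in_set_conv_nth)
      then have "3 \<le> y" using v_mono[of t "t + i"] t(2) by (cases "i = 0") (auto simp: v_def)
      moreover have "y \<in> {1..m}" using y w \<open>set w = {1..m}\<close> by auto
      ultimately show "y \<in> {3..<m + 1}" by auto
    qed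
    ultimately have "form_D w u (count_list v)"
      unfolding form_D_def using w sorted_eq_concat_replicate[OF sv] m_def by metis
    then show ?thesis by blast
  next
    case True
    then obtain g where g: "t < g" "g < length w" "w ! g = 1"
      and "\<forall>i<g. \<not> (t < i \<and> i < length w \<and> w ! i = 1)"
      using exists_least_iff[of "\<lambda>g. t < g \<and> g < length w \<and> w ! g = 1"] by blast
    then have g_min: "\<And>i. i < g \<Longrightarrow> t < i \<Longrightarrow> w ! i \<noteq> 1" by simp
    \<comment> \<open>The inserted block is the maximal run of 1s starting at \<open>g\<close>, the
      first 1 after the first 3; hence \<open>q\<close> is empty or begins with a letter other than
      1.\<close>
    define p ones q where "p = take g w" and "ones = takeWhile (\<lambda>x. x = 1) (drop g w)"
      and "q = dropWhile (\<lambda>x. x = 1) (drop g w)"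
    define b where "b = length ones"
    have "ones = replicate b 1"
      unfolding b_def ones_def
      by (metis (mono_tags, lifting) replicate_length_same set_takeWhileD)
    then have w: "w = p @ replicate b 1 @ q"
      by (metis append_take_drop_id ones_def p_def q_def takeWhile_dropWhile_id)
    have "drop g w = 1 # drop (Suc g) w" using g Cons_nth_drop_Suc by metis
    then have "1 \<le> b" by (simp add: b_def ones_def)
    have lenp: "length p = g" using g by (simp add: p_def)
    have q_nth: "q ! i = w ! (g + b + i)" for i
      by (subst w) (simp add: nth_append lenp)
    have lenw: "length w = g + b + length q"
      by (subst w) (simp add: lenp)
    have q0: "w ! (g + b) \<noteq> 1" if "q \<noteq> []"
      using that q_nth[of 0] hd_dropWhile[of "\<lambda>x. x = 1" "drop g w"] by (simp add: hd_conv_nth q_def)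
    have q_ne: "q ! i \<noteq> 1" if i: "i < length q" for i
    proof
      assume one: "q ! i = 1"
      have "q \<noteq> []" using i by auto
      have "i \<noteq> 0" using q0[OF \<open>q \<noteq> []\<close>] q_nth[of i] one by (intro notI) simp
      \<comment> \<open>A further 1 in \<open>q\<close> would create \<open>1 c 1\<close> with
        \<open>c = w ! (g + b)\<close>, taking the second 1 of the pattern from \<open>q\<close>.
        Avoidance then makes every earlier letter other than 1 before \<open>g\<close> equal to
        \<open>c\<close>, but both a 3 (at \<open>t\<close>) and a 2 (at \<open>i2\<close>) occur
        there.\<close>
      have *: "w ! h = w ! (g + b)" if "h < g" "w ! h \<noteq> 1" for h
        by (rule avoids_1_24_3D[OF av that(1), of "g + b" "g + b + i"])
          (use \<open>1 \<le> b\<close> \<open>i \<noteq> 0\<close> i lenw g one q_nth q0[OF \<open>q \<noteq> []\<close>] that in auto)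
      from *[of t] *[of i2] show False using t i2 g by simp
    qed
    have q_gt: "1 < x" if "x \<in> set q" for x
    proof -
      have "x \<noteq> 1" using that q_ne by (auto simp: in_set_conv_nth)
      moreover have "x \<in> set w" by (subst w) (simp add: that)
      then have "1 \<le> x" by (rule rgf_word_ge_1[OF rgf])
      ultimately show ?thesis by simp
    qed
    \<comment> \<open>No descent can end in \<open>q\<close>, which contains no 1.\<close>
    have le_q: "w ! j \<le> q ! i" if "j < g + b + i" "i < length q" for i j
      using avoids_descent_eq_1[OF rgf av that(1)] that(2) lenw q_nth[of i] q_ne[OF that(2)] by force
    have "sorted p"
      unfolding sorted_iff_nth_mono_less
    proof (intro allI impI)
      fix j k assume "j < k" "k < length p"
      then have jk: "j < k" "k < g" using lenp by auto
      show "p ! j \<le> p ! k"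
      proof (rule ccontr)
        assume "\<not> p ! j \<le> p ! k"
        then have gt: "w ! k < w ! j" using jk by (simp add: p_def)
        have k1: "w ! k = 1"
          by (rule avoids_descent_eq_1[OF rgf av jk(1) _ gt]) (use jk g in simp)
        \<comment> \<open>The 1 ending the descent lies before the first 3, because no 1 occurs
          between \<open>t\<close> and \<open>g\<close>. So the larger letter is a 2, and positions
          \<open>j, k, t, g\<close> read \<open>2 1 3 1\<close>.\<close>
        then have "k < t" using g_min[OF jk(2)] t(2) by (cases k t rule: linorder_cases) simp_all
        then have "w ! j = 2" using before[of j] jk gt k1 by auto
        then show False
          using avoids_1_24_3D[OF av jk(1) \<open>k < t\<close> g(1,2)] k1 g(3) t(2) by simp
      qed
    qed
    moreover have "sorted q"
      unfolding sorted_iff_nth_mono_less using le_q q_nth by simp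
    moreover have "x \<le> y" if x: "x \<in> set p" and y: "y \<in> set q" for x y
    proof -
      obtain j where j: "j < length p" "p ! j = x" using x by (auto simp: in_set_conv_nth)
      then have "j < g" "w ! j = x" unfolding lenp by (simp_all add: p_def)
      moreover obtain i where "i < length q" "q ! i = y" using y by (auto simp: in_set_conv_nth)
      ultimately show ?thesis using le_q[of j i] by simp
    qed
    ultimately have "sorted (p @ q)" by (auto simp: sorted_append)
    moreover have "last p \<noteq> hd q" if "q \<noteq> []"
    proof
      \<comment> \<open>A common value \<open>c\<close> satisfies \<open>c \<ge> 3\<close>, since
        the sorted word \<open>p\<close> contains the 3 at \<open>t\<close>. Then positions
        \<open>i2\<close>, \<open>g - 1\<close>, \<open>g\<close>, \<open>g + b\<close> read
        \<open>2 c 1 c\<close>.\<close>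
      assume eq: "last p = hd q"
      have last_p: "last p = w ! (g - 1)"
      proof -
        have "p \<noteq> []" using lenp g by auto
        then have "last p = p ! (g - 1)" by (simp add: last_conv_nth lenp)
        then show ?thesis using g(1) by (simp add: p_def)
      qed
      have "w ! t \<le> w ! (g - 1)"
        using \<open>sorted p\<close> g(1) lenp sorted_nth_mono[of p t "g - 1"] by (simp add: p_def)
      then have ge: "3 \<le> w ! (g - 1)" using t(2) by simp
      have "hd q = w ! (g + b)" using that q_nth[of 0] by (simp add: hd_conv_nth)
      then have "w ! (g - 1) = w ! (g + b)" using eq last_p by simp
      moreover have "i2 < g - 1" "g - 1 < g" "g < g + b" "g + b < length w"
        using i2 g \<open>1 \<le> b\<close> lenw that by auto
      ultimately have "w ! i2 = w ! g"
        using avoids_1_24_3D[OF av, of i2 "g - 1" g "g + b"] i2 ge g(3) by simp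
      then show False using i2 g by simp
    qed
    ultimately have "form_C w p b q"
      unfolding form_C_def using w \<open>1 \<le> b\<close> lenp g by auto
    then show ?thesis by blast
  qed
qed

section \<open>Statistics of each form\<close>

lemma form_C_statistics:
  fixes p q :: "nat list"
  assumes rgf: "rgf_word w" and C: "form_C w p b q" and m: "m = Max (set w)" and x: "x = last p"
  defines "a \<equiv> (\<lambda>i. int (count_list (p @ q) i))"
  shows "int (lb w) = (int x - 1) * int b
    \<and> int (rs w) = (\<Sum>i=2..x. a i)
    \<and> int (rb w) = (\<Sum>i=1..m. (int m - int i) * a i) + (int m - int x) * int b
    \<and> int (ls w) = (\<Sum>i=1..m. (int i - 1) * a i)"
proof (intro conjI)
  have w: "w = p @ replicate b 1 @ q" and b: "1 \<le> b" and srt: "sorted (p @ q)" and "p \<noteq> []"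
    and pq: "q = [] \<or> last p \<noteq> hd q"
    using C by (auto simp: form_C_def)
  have "w \<noteq> []" using w \<open>p \<noteq> []\<close> by simp
  then have set_w: "set w = {1..m}" using set_rgf_word[OF rgf] m by simp
  have p_x: "p = butlast p @ [x]" using x \<open>p \<noteq> []\<close> by simp
  have sp: "sorted p" and sq: "sorted q" and spq: "\<And>y z. y \<in> set p \<Longrightarrow> z \<in> set q \<Longrightarrow> y \<le> z"
    using srt by (auto simp: sorted_append)
  have "x \<in> set p" using x \<open>p \<noteq> []\<close> by simp
  have p_le: "y \<le> x" if "y \<in> set p" for y
  proof -
    have "sorted (butlast p @ [x])" using sp p_x by simp
    moreover have "y \<in> set (butlast p @ [x])" using that p_x by simp
    ultimately show ?thesis by (auto simp: sorted_append)
  qed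
  then have "Max (set p) = x" using \<open>x \<in> set p\<close> by (intro Max_eqI) auto
  moreover have "rgf_word p" using rgf w rgf_word_prefix by blast
  ultimately have set_p: "set p = {1..x}" using set_rgf_word[OF _ \<open>p \<noteq> []\<close>] by simp
  \<comment> \<open>Sortedness gives only \<open>x \<le> y\<close>; the condition
    \<open>last p \<noteq> hd q\<close> makes it strict.\<close>
  have q_gt: "x < y" if "y \<in> set q" for y
  proof (cases q)
    case (Cons z q')
    then have "x \<le> z" "z \<le> y" using spq[OF \<open>x \<in> set p\<close>] that sq by auto
    moreover have "x \<noteq> z" using pq Cons x by simp
    ultimately show ?thesis by simp
  qed (use that in simp)
  have "1 \<le> x" using set_p \<open>x \<in> set p\<close> by auto
  have "x \<le> m" using \<open>x \<in> set p\<close> set_w w by auto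
  \<comment> \<open>The inserted 1s add no new value, as \<open>p\<close> already contains 1; so the
    values of \<open>q\<close> are exactly those above \<open>x\<close>.\<close>
  have un: "{1..m} = {1..x} \<union> set q"
  proof -
    have "set w = insert 1 ({1..x} \<union> set q)" using w set_p b by auto
    also have "\<dots> = {1..x} \<union> set q" by (rule insert_absorb) (use \<open>1 \<le> x\<close> in simp)
    finally show ?thesis using set_w by simp
  qed
  have set_q: "set q = {x + 1..m}"
  proof
    have "set q \<subseteq> {1..m}" using un by blast
    then show "set q \<subseteq> {x + 1..m}" using q_gt by fastforce
    show "{x + 1..m} \<subseteq> set q"
    proof
      fix y assume "y \<in> {x + 1..m}"
      then have "y \<in> {1..m}" "y \<notin> {1..x}" by auto
      then show "y \<in> set q" unfolding un by blast
    qed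
  qed

  have in_ones: "y = 1 \<and> set c \<subseteq> {1} \<and> set d \<subseteq> {1}" if "replicate b 1 = c @ y # d" for c d and y :: nat
  proof -
    have "set (c @ y # d) \<subseteq> {1}" using that by (metis set_replicate_conv_if empty_subsetI subset_refl)
    then show ?thesis by auto
  qed

  \<comment> \<open>Each inserted 1 sees the values \<open>2, ..., x\<close> of \<open>p\<close> to
    its left.\<close>
  have "card {z \<in> set p \<union> set c. y < z} = x - 1" if "replicate b 1 = c @ y # d" for c y d
  proof -
    have "{z \<in> set p \<union> set c. y < z} = {2..x}"
      using in_ones[OF that] set_p by auto
    then show ?thesis by simp
  qed
  from lb_append_map[of "replicate b 1" p, OF this]
  have "lb (p @ replicate b 1) = b * (x - 1)"
    by (simp add: lb_sorted[OF sp] sum_list_replicate map_replicate_const)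
  moreover have "lb ((p @ replicate b 1) @ q) = lb (p @ replicate b 1)"
    by (rule lb_append_sorted[OF sq]) (use q_gt \<open>1 \<le> x\<close> spq in fastforce)
  ultimately have "lb w = b * (x - 1)" using w by simp
  then show "int (lb w) = (int x - 1) * int b"
    using \<open>1 \<le> x\<close> by (simp add: of_nat_diff)

  \<comment> \<open>The only smaller value to the right of a letter of \<open>p\<close> is the
    inserted 1. It counts once whatever \<open>b\<close> is, and not at all for the letter
    1.\<close>
  have "card {z \<in> set d \<union> set (replicate b 1 @ q). z < y} = (if 2 \<le> y then 1 else 0)"
    if p: "p = c @ y # d" for c y d
  proof -
    have "1 \<le> y" using set_p p by auto
    moreover have "\<forall>z \<in> set d. \<not> z < y" using sp p by (auto simp: sorted_append not_less)
    moreover have "\<forall>z \<in> set q. \<not> z < y" using spq[of y] p by (simp add: not_less)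
    ultimately have "{z \<in> set d \<union> set (replicate b 1 @ q). z < y} = (if 2 \<le> y then {1} else {})"
      using b by (auto split: if_splits)
    then show ?thesis by simp
  qed
  from rs_append_map[of p "replicate b 1 @ q", OF this]
  have "rs w = sum_list (map (\<lambda>y. if 2 \<le> y then 1 else 0) p) + rs (replicate b 1 @ q)"
    using w by simp
  moreover have "rs (replicate b 1 @ q) = rs q"
    by (rule rs_append_sorted) (use q_gt \<open>1 \<le> x\<close> in \<open>fastforce simp: sorted_replicate\<close>)+
  ultimately have "rs w = (\<Sum>i=1..x. count_list p i * (if 2 \<le> i then 1 else 0))"
    using rs_sorted[OF sq] sum_list_map_eq_sum_count2[of p "{1..x}"] set_p by simp
  also have "\<dots> = (\<Sum>i=2..x. count_list p i)"
    by (rule sum.mono_neutral_cong_right) auto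
  also have "\<dots> = (\<Sum>i=2..x. count_list (p @ q) i)"
    by (rule sum.cong) (auto simp: set_q count_list_0_iff)
  finally show "int (rs w) = (\<Sum>i=2..x. a i)" by (simp add: a_def)

  \<comment> \<open>To the right of a letter \<open>y\<close> of \<open>p\<close>, the rest of
    \<open>p\<close> supplies the values up to \<open>x\<close> and \<open>q\<close> those above
    \<open>x\<close>, so all of \<open>y + 1, ..., m\<close> are seen.\<close>
  have "card {z \<in> set d \<union> set (replicate b 1 @ q). y < z} = m - y"
    if p: "p = c @ y # d" for c y d
  proof -
    have "y \<le> x" "1 \<le> y" using p set_p by auto
    have "\<And>z. z \<in> set c \<Longrightarrow> z \<le> y" using sp p by (auto simp: sorted_append)
    moreover have "{1..x} = set c \<union> {y} \<union> set d" using p set_p by auto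
    ultimately have "{z. y < z \<and> z \<le> x} \<subseteq> set d" "set d \<subseteq> {1..x}" by fastforce+
    then have "{z \<in> set d \<union> set (replicate b 1 @ q). y < z} = {y<..m}"
      using set_q \<open>y \<le> x\<close> \<open>x \<le> m\<close> \<open>1 \<le> y\<close> by fastforce
    then show ?thesis by simp
  qed
  from rb_append_map[of p "replicate b 1 @ q", OF this]
  have rb1: "rb w = sum_list (map (\<lambda>y. m - y) p) + rb (replicate b 1 @ q)"
    using w by simp
  have "card {z \<in> set d \<union> set q. y < z} = m - x" if "replicate b 1 = c @ y # d" for c y d
  proof -
    have "{z \<in> set d \<union> set q. y < z} = {x + 1..m}"
      using in_ones[OF that] set_q \<open>1 \<le> x\<close> by auto
    then show ?thesis by simp
  qed
  from rb_append_map[of "replicate b 1" q, OF this]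
  have "rb (replicate b 1 @ q) = b * (m - x) + sum_list (map (\<lambda>y. m - y) q)"
    by (simp add: rb_sorted[OF sq set_q] sum_list_replicate map_replicate_const)
  with rb1 have "rb w = sum_list (map (\<lambda>y. m - y) (p @ q)) + b * (m - x)" by simp
  moreover have "set (p @ q) \<subseteq> {1..m}" using set_p set_q \<open>x \<le> m\<close> by auto
  ultimately show "int (rb w) = (\<Sum>i=1..m. (int m - int i) * a i) + (int m - int x) * int b"
    using sum_list_weight[of "p @ q" 1 m] \<open>x \<le> m\<close> by (simp add: a_def of_nat_diff)

  show "int (ls w) = (\<Sum>i=1..m. (int i - 1) * a i)"
    \<comment> \<open>Inserting 1s changes only the count of the value 1, whose weight
      \<open>i - 1\<close> is 0.\<close>
    unfolding ls_rgf_word_sum[OF rgf \<open>w \<noteq> []\<close> m] a_def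
    by (rule sum.cong) (auto simp: w count_list_replicate_if)
qed

text \<open>All letters of \<open>u\<close> lie below those of \<open>v\<close>, so each statistic
  splits between the two words. On \<open>u\<close> it is read off by cutting at the first 2 for
  \<open>lb\<close>, the last 1 for \<open>rs\<close> and the last 2 for \<open>rb\<close>.\<close>

lemma form_D_statistics:
  assumes rgf: "rgf_word w" and "w \<noteq> []" and D: "form_D w u b" and m: "m = Max (set w)" "2 < m"
  defines "a \<equiv> (\<lambda>i. int (count_list w i))"
  shows "(\<forall>i\<in>{3..m}. a i = int (b i))
    \<and> int (lb w) = a 1 - int (first_pos 2 u) + 1
    \<and> int (rs w) = int (last_pos 1 u) - a 1
    \<and> int (rb w) = (int (last_pos 2 u) - a 2) * (int m - 1)
      + (int (length u) - int (last_pos 2 u)) * (int m - 2) + (\<Sum>i=2..m-1. (int m - int i) * a i)"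
proof (intro conjI)
  define v where "v = concat (map (\<lambda>i. replicate (b i) i) [3..<m + 1])"
  have w: "w = u @ v" and u: "set u \<subseteq> {1, 2}"
    using D by (auto simp: form_D_def v_def m)
  have set_w: "set w = {1..m}" using set_rgf_word[OF rgf \<open>w \<noteq> []\<close>] m by simp
  have sv: "sorted v" unfolding v_def by (rule sorted_concat_replicate)
  have v_sub: "set v \<subseteq> {3..m}" by (auto simp: v_def)
  have v: "set v = {3..m}"
  proof
    show "{3..m} \<subseteq> set v"
    proof
      fix i assume "i \<in> {3..m}"
      then have "i \<in> set w" "i \<notin> set u" using set_w u by auto
      then show "i \<in> set v" using w by simp
    qed
  qed (rule v_sub)
  have in_u: "1 \<in> set u" "2 \<in> set u"
  proof -
    have "1 \<in> set w" "2 \<in> set w" using set_w m(2) by simp_all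
    then show "1 \<in> set u" "2 \<in> set u" using w v by auto
  qed
  have count_u: "count_list w i = count_list u i" if "i \<in> {1, 2}" for i
    using w v that by (auto simp: count_list_0_iff)
  have less: "x < y" if "x \<in> set u" "y \<in> set v" for x y
    using that u v by fastforce
  show "\<forall>i\<in>{3..m}. a i = int (b i)"
  proof
    fix i assume i: "i \<in> {3..m}"
    then have "i \<notin> set u" using u by auto
    then show "a i = int (b i)"
      using i by (simp add: a_def w v_def count_list_concat_replicate del: upt_Suc)
  qed

  \<comment> \<open>The \<open>c - 1\<close> letters before the first 2 are all 1s, which leaves
    \<open>a_1 - (c - 1)\<close> 1s after it.\<close>
  obtain ys zs where yz: "u = ys @ 2 # zs" "2 \<notin> set ys"
    using split_list_first[OF in_u(2)] by blast
  then have ones: "set ys \<subseteq> {1}" "set zs \<subseteq> {1, 2}" using u by auto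
  have "lb w = lb u"
    unfolding w by (rule lb_append_sorted[OF sv]) (use less in fastforce)
  also have "\<dots> = count_list zs 1" unfolding yz(1) by (rule lb_binary[OF ones])
  finally have "lb w = count_list zs 1" .
  moreover have "length ys = count_list ys 1"
    using length_binary[of ys] ones yz(2) by fastforce
  ultimately show "int (lb w) = a 1 - int (first_pos 2 u) + 1"
    unfolding yz(1) first_pos_append[OF yz(2)] by (simp add: a_def count_u yz(1))

  \<comment> \<open>The first \<open>f\<close> letters contain all \<open>a_1\<close> of the 1s, so
    \<open>f - a_1\<close> of them are 2s.\<close>
  obtain ys zs where yz: "u = ys @ 1 # zs" "1 \<notin> set zs"
    using split_list_last[OF in_u(1)] by blast
  then have twos: "set ys \<subseteq> {1, 2}" "set zs \<subseteq> {2}" using u by auto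
  have "rs w = rs u + rs v"
    unfolding w by (rule rs_append_less) (use less in blast)
  also have "rs u = count_list ys 2" unfolding yz(1) by (rule rs_binary[OF twos])
  finally have "rs w = count_list ys 2" using rs_sorted[OF sv] by simp
  then show "int (rs w) = int (last_pos 1 u) - a 1"
    using length_binary[OF twos(1)] yz(2)
    unfolding yz(1) last_pos_append[OF yz(2)] by (simp add: a_def count_u yz(1))

  obtain ys zs where yz: "u = ys @ 2 # zs" "2 \<notin> set zs"
    using split_list_last[OF in_u(2)] by blast
  then have ones: "set ys \<subseteq> {1, 2}" "set zs \<subseteq> {1}" using u by auto
  have "rb u = count_list ys 1" unfolding yz(1) by (rule rb_binary[OF ones])
  have "rb w = rb u + length u * card (set v) + rb v"
    unfolding w by (rule rb_append_less) (use less in blast)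
  then have rb_w: "int (rb w) = int (count_list ys 1) + int (length u) * (int m - 2) + int (rb v)"
    using v m \<open>rb u = _\<close> by (simp add: of_nat_diff)
  have rb_v: "int (rb v) = (\<Sum>i=3..m-1. (int m - int i) * a i)"
  proof -
    have "int (rb v) = (\<Sum>i=3..m. (int m - int i) * int (count_list v i))"
      unfolding rb_sorted[OF sv v] by (rule sum_list_weight[OF v_sub])
    \<comment> \<open>The term for \<open>i = m\<close> has weight 0, and letters from 3 on occur
      only in \<open>v\<close>.\<close>
    also have "\<dots> = (\<Sum>i=3..m-1. (int m - int i) * a i)"
    proof (rule sum.mono_neutral_cong_right)
      fix i assume "i \<in> {3..m-1}"
      then have "i \<notin> set u" using u by auto
      then show "(int m - int i) * int (count_list v i) = (int m - int i) * a i"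
        by (simp add: a_def w)
    qed auto
    finally show ?thesis .
  qed
  have sum2: "(\<Sum>i=2..m-1. (int m - int i) * a i) = (int m - 2) * a 2 + (\<Sum>i=3..m-1. (int m - int i) * a i)"
    using m by (subst sum.atLeast_Suc_atMost) (auto simp: numeral_3_eq_3 numeral_2_eq_2)
  have last2: "int (last_pos 2 u) - a 2 = int (count_list ys 1)"
    using length_binary[OF ones(1)] yz(2)
    unfolding yz(1) last_pos_append[OF yz(2)] by (simp add: a_def count_u yz(1))
  \<comment> \<open>Every letter of \<open>u\<close> sees the \<open>m - 2\<close> values of
    \<open>v\<close>, and the \<open>d - a_2\<close> 1s before the last 2 see one more. The stated
    formula distributes this total among those 1s, the letters after position \<open>d\<close>, and
    the 2s, which form the term \<open>i = 2\<close>.\<close>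
  have "c + k * (M - 2) + r = (d - z) * (M - 1) + (k - d) * (M - 2) + ((M - 2) * z + r)"
    if "d - z = c" for c d k M r z :: int
    unfolding that[symmetric] by (simp add: algebra_simps)
  from this[OF last2] show "int (rb w) = (int (last_pos 2 u) - a 2) * (int m - 1)
      + (int (length u) - int (last_pos 2 u)) * (int m - 2) + (\<Sum>i=2..m-1. (int m - int i) * a i)"
    unfolding rb_w rb_v sum2 by blast
qed

lemma rb_sorted_rgf_word:
  assumes "rgf_word w" "w \<noteq> []" "m = Max (set w)" "sorted w"
  shows "int (rb w) = (\<Sum>i=1..m. (int m - int i) * int (count_list w i))"
proof -
  have "set w = {1..m}" using set_rgf_word[OF assms(1,2)] assms(3) by simp
  then show ?thesis
    using rb_sorted[OF assms(4), of 1 m] sum_list_weight[of w 1 m] by simp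
qed

lemma ls_binary:
  assumes "rgf_word w" "set w \<subseteq> {1, 2}"
  shows "ls w = count_list w 2"
  unfolding ls_rgf_word[OF assms(1)] using assms(2) by (induction w) auto

text \<open>The same three cuts: the first 2 begins \<open>w'\<close>, and the last 1 ends the block
  of length \<open>j\<close>. The last 2 ends \<open>w'\<close> if \<open>k = 0\<close> and ends
  \<open>w\<close> otherwise, whence the case distinction in \<open>rb\<close>.\<close>

lemma binary_block_statistics:
  assumes w: "w = replicate i 1 @ w' @ replicate j 1 @ replicate k 2"
    and ij: "1 \<le> j" and w': "w' \<noteq> []" "hd w' = 2" "last w' = 2" and set_w: "set w \<subseteq> {1, 2}"
  shows "int (lb w) = int (count_list w 1) - int i
    \<and> int (rb w) = int (count_list w 1) - (if k = 0 then 1 else 0) * int j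
    \<and> int (rs w) = int (length w) - int (count_list w 1) - int k"
proof (intro conjI)
  have sw': "set w' \<subseteq> {1, 2}" using set_w w by auto
  have hd: "w' = 2 # tl w'" using w' by (metis list.collapse)
  have last: "w' = butlast w' @ [2]" using w' by (metis append_butlast_last_id)
  have tl: "set (tl w') \<subseteq> {1, 2}" and but: "set (butlast w') \<subseteq> {1, 2}"
    using sw' list.set_sel(2)[OF w'(1)] in_set_butlastD[of _ w'] by blast+

  have eq: "w = replicate i 1 @ 2 # (tl w' @ replicate j 1 @ replicate k 2)"
    by (subst w, subst hd) simp
  have "lb w = count_list (tl w' @ replicate j 1 @ replicate k 2) 1"
    unfolding eq by (rule lb_binary) (use tl in auto)
  moreover have "count_list w' 1 = count_list (tl w') 1" by (subst hd) simp
  ultimately show "int (lb w) = int (count_list w 1) - int i"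
    by (simp add: w count_list_replicate_if)

  \<comment> \<open>As \<open>j\<close> is positive, the last 1 can be split off.\<close>
  have "replicate j 1 = replicate (j - 1) 1 @ [1::nat]"
    using ij by (metis One_nat_def Suc_pred replicate_append_same replicate_Suc less_eq_Suc_le)
  then have eq: "w = (replicate i 1 @ w' @ replicate (j - 1) 1) @ 1 # replicate k 2"
    using w by simp
  have "rs w = count_list (replicate i 1 @ w' @ replicate (j - 1) 1) 2"
    unfolding eq by (rule rs_binary) (use sw' in auto)
  moreover have "int (length w) - int (count_list w 1) = int (count_list w 2)"
    using length_binary[OF set_w] by simp
  ultimately show "int (rs w) = int (length w) - int (count_list w 1) - int k"
    by (simp add: w count_list_replicate_if)

  show "int (rb w) = int (count_list w 1) - (if k = 0 then 1 else 0) * int j"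
  proof (cases k)
    case 0
    have eq: "w = (replicate i 1 @ butlast w') @ 2 # replicate j 1"
      by (subst w, subst last) (simp add: 0)
    have "rb w = count_list (replicate i 1 @ butlast w') 1"
      unfolding eq by (rule rb_binary) (use but in auto)
    moreover have "count_list w' 1 = count_list (butlast w') 1" by (subst last) simp
    ultimately show ?thesis by (simp add: w 0 count_list_replicate_if)
  next
    case (Suc k')
    have eq: "w = (replicate i 1 @ w' @ replicate j 1 @ replicate k' 2) @ 2 # []"
      unfolding w Suc by (simp add: replicate_append_same)
    have "rb w = count_list (replicate i 1 @ w' @ replicate j 1 @ replicate k' 2) 1"
      unfolding eq by (rule rb_binary) (use sw' in auto)
    then show ?thesis by (simp add: w Suc count_list_replicate_if)
  qed
qed

theorem theorem4p7:
  fixes n m l :: nat and w :: "nat list"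
  assumes "1 \<le> n"
    and "w \<in> R n pat_1_24_3"
    and "m = Max (set w)"
    and "l = count_list w 1"
  shows
    "(m \<le> 2 \<or> sorted w \<or> (\<exists>p b q. form_C w p b q) \<or> (\<exists>u b. form_D w u b))
     \<and>
     (m \<le> 2 \<longrightarrow>
        int (ls w) = int n - int l
      \<and> (sorted w \<longrightarrow> lb w = 0 \<and> rb w = (if m = 1 then 0 else l) \<and> rs w = 0)
      \<and> (\<forall>i j k w'.
           1 \<le> i \<and> 1 \<le> j \<and> w' \<noteq> [] \<and> hd w' = 2 \<and> last w' = 2 \<and>
           w = replicate i 1 @ w' @ replicate j 1 @ replicate k 2 \<longrightarrow>
             int (lb w) = int l - int i
           \<and> int (rb w) = int l - (if k = 0 then 1 else 0) * int j
           \<and> int (rs w) = int n - int l - int k))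
     \<and>
     (\<not> m \<le> 2 \<longrightarrow>
        (sorted w \<longrightarrow>
          (let a = (\<lambda>i. int (count_list w i)) in
             lb w = 0
           \<and> rs w = 0
           \<and> int (rb w) = (\<Sum>i=1..m. (int m - int i) * a i)
           \<and> int (ls w) = (\<Sum>i=1..m. (int i - 1) * a i)))
      \<and> (\<forall>p b1 q. form_C w p b1 q \<longrightarrow>
          (let a = (\<lambda>i. int (count_list (p @ q) i)); x = last p in
             int (lb w) = (int x - 1) * int b1
           \<and> int (rs w) = (\<Sum>i=2..x. a i)
           \<and> int (rb w) = (\<Sum>i=1..m. (int m - int i) * a i) + (int m - int x) * int b1
           \<and> int (ls w) = (\<Sum>i=1..m. (int i - 1) * a i)))
      \<and> (\<forall>u b. form_D w u b \<longrightarrow>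
          (let a = (\<lambda>i. int (count_list w i));
               c = int (first_pos 2 u); d = int (last_pos 2 u); f = int (last_pos 1 u) in
             (\<forall>i\<in>{3..m}. a i = int (b i))
           \<and> int (lb w) = a 1 - c + 1
           \<and> int (rs w) = f - a 1
           \<and> int (rb w) = (d - a 2) * (int m - 1) + (int (length u) - d) * (int m - 2)
                           + (\<Sum>i=2..m-1. (int m - int i) * a i)
           \<and> int (ls w) = (\<Sum>i=1..m. (int i - 1) * a i))))"
proof (intro conjI)
  note rgf = rgf_word_R[OF assms(2)] and av = avoids_R[OF assms(2)] and len = length_R[OF assms(2)]
  have ne: "w \<noteq> []" using len assms(1) by auto
  have set_w: "set w = {1..m}" using set_rgf_word[OF rgf ne] assms(3) by simp
  have "1 \<le> m" using set_w ne by (cases "m = 0") auto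
  show "m \<le> 2 \<or> sorted w \<or> (\<exists>p b q. form_C w p b q) \<or> (\<exists>u b. form_D w u b)"
    using avoids_1_24_3_cases[OF rgf av ne] assms(3) by (meson not_le)
  show "m \<le> 2 \<longrightarrow>
        int (ls w) = int n - int l
      \<and> (sorted w \<longrightarrow> lb w = 0 \<and> rb w = (if m = 1 then 0 else l) \<and> rs w = 0)
      \<and> (\<forall>i j k w'.
           1 \<le> i \<and> 1 \<le> j \<and> w' \<noteq> [] \<and> hd w' = 2 \<and> last w' = 2 \<and>
           w = replicate i 1 @ w' @ replicate j 1 @ replicate k 2 \<longrightarrow>
             int (lb w) = int l - int i
           \<and> int (rb w) = int l - (if k = 0 then 1 else 0) * int j
           \<and> int (rs w) = int n - int l - int k)"
  proof (rule impI, intro conjI)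
    assume m2: "m \<le> 2"
    then have bin: "set w \<subseteq> {1, 2}" using set_w by auto
    show "int (ls w) = int n - int l"
      using ls_binary[OF rgf bin] length_binary[OF bin] len assms(4) by simp
    show "sorted w \<longrightarrow> lb w = 0 \<and> rb w = (if m = 1 then 0 else l) \<and> rs w = 0"
    proof
      assume srt: "sorted w"
      \<comment> \<open>For \<open>m = 1\<close> the sole weight \<open>m - 1\<close> is 0, as no
        larger letter exists. For \<open>m = 2\<close> the weight of the letter 1 is 1 and that of 2
        is 0, leaving \<open>l\<close>.\<close>
      note rb = rb_sorted_rgf_word[OF rgf ne assms(3) srt]
      consider "m = 1" | "m = 2" using m2 \<open>1 \<le> m\<close> by linarith
      then have "rb w = (if m = 1 then 0 else l)"
        by cases (use rb assms(4) in \<open>simp_all add: numeral_2_eq_2\<close>)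
      then show "lb w = 0 \<and> rb w = (if m = 1 then 0 else l) \<and> rs w = 0"
        using lb_sorted[OF srt] rs_sorted[OF srt] by simp
    qed
    show "\<forall>i j k w'.
           1 \<le> i \<and> 1 \<le> j \<and> w' \<noteq> [] \<and> hd w' = 2 \<and> last w' = 2 \<and>
           w = replicate i 1 @ w' @ replicate j 1 @ replicate k 2 \<longrightarrow>
             int (lb w) = int l - int i
           \<and> int (rb w) = int l - (if k = 0 then 1 else 0) * int j
           \<and> int (rs w) = int n - int l - int k"
    proof (intro allI impI, elim conjE)
      fix i j k w'
      assume "1 \<le> j" "w' \<noteq> []" "hd w' = 2" "last w' = 2"
        and eq: "w = replicate i 1 @ w' @ replicate j 1 @ replicate k 2"
      note st = binary_block_statistics[OF eq this(1-4) bin]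
      show "int (lb w) = int l - int i
           \<and> int (rb w) = int l - (if k = 0 then 1 else 0) * int j
           \<and> int (rs w) = int n - int l - int k"
        unfolding assms(4) len[symmetric] by (fact st)
    qed
  qed
  show "\<not> m \<le> 2 \<longrightarrow>
        (sorted w \<longrightarrow>
          (let a = (\<lambda>i. int (count_list w i)) in
             lb w = 0
           \<and> rs w = 0
           \<and> int (rb w) = (\<Sum>i=1..m. (int m - int i) * a i)
           \<and> int (ls w) = (\<Sum>i=1..m. (int i - 1) * a i)))
      \<and> (\<forall>p b1 q. form_C w p b1 q \<longrightarrow>
          (let a = (\<lambda>i. int (count_list (p @ q) i)); x = last p in
             int (lb w) = (int x - 1) * int b1
           \<and> int (rs w) = (\<Sum>i=2..x. a i)
           \<and> int (rb w) = (\<Sum>i=1..m. (int m - int i) * a i) + (int m - int x) * int b1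
           \<and> int (ls w) = (\<Sum>i=1..m. (int i - 1) * a i)))
      \<and> (\<forall>u b. form_D w u b \<longrightarrow>
          (let a = (\<lambda>i. int (count_list w i));
               c = int (first_pos 2 u); d = int (last_pos 2 u); f = int (last_pos 1 u) in
             (\<forall>i\<in>{3..m}. a i = int (b i))
           \<and> int (lb w) = a 1 - c + 1
           \<and> int (rs w) = f - a 1
           \<and> int (rb w) = (d - a 2) * (int m - 1) + (int (length u) - d) * (int m - 2)
                           + (\<Sum>i=2..m-1. (int m - int i) * a i)
           \<and> int (ls w) = (\<Sum>i=1..m. (int i - 1) * a i)))"
    unfolding Let_def
  proof (intro impI conjI allI)
    assume "\<not> m \<le> 2"
    show "lb w = 0" "rs w = 0" if "sorted w"
      using that by (rule lb_sorted, rule rs_sorted)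
    show "int (rb w) = (\<Sum>i=1..m. (int m - int i) * int (count_list w i))" if "sorted w"
      by (rule rb_sorted_rgf_word[OF rgf ne assms(3) that])
    \<comment> \<open>In forms (B) and (D) alike, \<open>a\<close> counts the letters of
      \<open>w\<close> itself, so the two goals coincide.\<close>
    show "int (ls w) = (\<Sum>i=1..m. (int i - 1) * int (count_list w i))"
      "int (ls w) = (\<Sum>i=1..m. (int i - 1) * int (count_list w i))"
      by (fact ls_rgf_word_sum[OF rgf ne assms(3)])+
    fix p b1 q assume C: "form_C w p b1 q"
    note st = form_C_statistics[OF rgf C assms(3) refl]
    show "int (lb w) = (int (last p) - 1) * int b1"
      "int (rs w) = (\<Sum>i=2..last p. int (count_list (p @ q) i))"
      "int (rb w) = (\<Sum>i=1..m. (int m - int i) * int (count_list (p @ q) i))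
         + (int m - int (last p)) * int b1"
      "int (ls w) = (\<Sum>i=1..m. (int i - 1) * int (count_list (p @ q) i))"
      using st by blast+
  next
    fix u b
    assume "\<not> m \<le> 2" and D: "form_D w u b"
    then have m: "2 < m" by simp
    note st = form_D_statistics[OF rgf ne D assms(3) m]
    show "\<forall>i\<in>{3..m}. int (count_list w i) = int (b i)"
      "int (lb w) = int (count_list w 1) - int (first_pos 2 u) + 1"
      "int (rs w) = int (last_pos 1 u) - int (count_list w 1)"
      "int (rb w) = (int (last_pos 2 u) - int (count_list w 2)) * (int m - 1)
        + (int (length u) - int (last_pos 2 u)) * (int m - 2)
        + (\<Sum>i=2..m-1. (int m - int i) * int (count_list w i))"
      using st by blast+
  qed
qed

end
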